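(* Let $0<\alpha<1$, let $\mathbf{x}\in\mathbb{R}^N$ have exactly $K$ nonzero coordinates with $0<K<N$, let $s_{ij}$ ($1\le i\le N$, $1\le j\le M$) be i.i.d. $S(\alpha,1)$, $y_j=\sum_{i=1}^N x_is_{ij}$, and for each $i$ let $\hat x_{i,min}=y_t/s_{it}$ with $t=\arg\min_{1\le j\le M}|y_j/s_{ij}|$. Let $\epsilon>0$, $\theta=\left(\sum_{i}|x_i|^\alpha\right)^{1/\alpha}$, $\psi=(\epsilon/\theta)^{\alpha/(1-\alpha)}$ with $\psi\le 1/3$, and $\delta>0$. If $$M\ge \frac{\log\left((N-K)/\delta\right)}{\log(1+\psi)},$$ then the expected number of false positives, i.e. of indices $i$ with $x_i=0$ and $|\hat x_{i,min}|>\epsilon$, is at most $\delta$.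
   Context: A random variable $Z$ has the symmetric $\alpha$-stable distribution with unit scale, $S(\alpha,1)$, if its characteristic function is $E e^{\sqrt{-1}Zt}=e^{-|t|^\alpha}$. *)

theory Defs
  imports "HOL-Probability.Probability"
begin

definition sas_law :: "real \<Rightarrow> real measure \<Rightarrow> bool" where
  "sas_law \<alpha> \<mu> \<longleftrightarrow> (\<forall>t. char \<mu> t = complex_of_real (exp (- (\<bar>t\<bar> powr \<alpha>))))"

definition meas :: "nat \<Rightarrow> (nat \<Rightarrow> real) \<Rightarrow> (nat \<Rightarrow> nat \<Rightarrow> 'a \<Rightarrow> real) \<Rightarrow> nat \<Rightarrow> 'a \<Rightarrow> real" where
  "meas N x s j \<omega> = (\<Sum>i<N. x i * s i j \<omega>)"

definition xhat_min :: "nat \<Rightarrow> nat \<Rightarrow> (nat \<Rightarrow> real) \<Rightarrow> (nat \<Rightarrow> nat \<Rightarrow> 'a \<Rightarrow> real) \<Rightarrow> nat \<Rightarrow> 'a \<Rightarrow> real" where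
  "xhat_min N M x s i \<omega> =
     (let t = arg_min_on (\<lambda>j. \<bar>meas N x s j \<omega> / s i j \<omega>\<bar>) {..<M}
      in meas N x s t \<omega> / s i t \<omega>)"

end

theory Submission
  imports Defs "HOL-Real_Asymp.Real_Asymp"
begin

text \<open>
  If \<open>x\<^sub>i = 0\<close>, then the event that the estimate of \<open>x\<^sub>i\<close> exceeds \<open>\<epsilon>\<close> in absolute value is the intersection of \<open>M\<close> independent events
  \<open>|y\<^sub>j| > \<epsilon> |s\<^sub>i\<^sub>j|\<close>, so it suffices to bound each of their probabilities by \<open>1 / (1 + \<psi>)\<close>.
  The variables \<open>Y = y\<^sub>j\<close> and \<open>S = \<epsilon> s\<^sub>i\<^sub>j\<close> have joint characteristic function
  \<open>exp (- (p |t|\<^sup>\<alpha> + q |u|\<^sup>\<alpha>))\<close> with \<open>p = \<theta>\<^sup>\<alpha>\<close> and \<open>q = \<epsilon>\<^sup>\<alpha> \<le> p\<close>, and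
  \<open>P (|Y| > |S|) \<le> (1 + E (sgn (Y - S) sgn (Y + S))) / 2\<close>. Writing each sign as
  \<open>(2 / \<pi>) \<integral> sin (t x) / t dt\<close> over \<open>t > 0\<close> turns the expectation into a double integral whose
  integrand is nonnegative, being a difference of two values of the characteristic function.
  Substituting \<open>u = t v\<close> and applying Frullani's formula in \<open>t\<close> leaves a constant times
  \<open>\<integral> ln ((p b + q a) / (p a + q b)) dv / v\<close> with \<open>a = |1 - v|\<^sup>\<alpha>\<close> and \<open>b = (1 + v)\<^sup>\<alpha>\<close>.
  The logarithm is at most \<open>(p - q) / (p + q) ln (b / a)\<close>, and the integral of \<open>ln (b / a)\<close> is the
  one obtained for \<open>S = 0\<close>, where the expectation is at most 1. Hence
  \<open>P (|Y| > |S|) \<le> p / (p + q) = 1 / (1 + (\<epsilon> / \<theta>)\<^sup>\<alpha>)\<close>, and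
  \<open>(\<epsilon> / \<theta>)\<^sup>\<alpha> \<ge> \<psi>\<close> because \<open>\<epsilon> \<le> \<theta>\<close>.
\<close>

section \<open>The sign function as a limit of truncated Dirichlet integrals\<close>

text \<open>The Dirichlet integral converges only conditionally at infinity, and for Fubini the
  singular factor \<open>1 / t\<close> also has to stay away from 0, so both ends are cut.
  \<open>Suc n\<close> keeps the lower end defined at \<open>n = 0\<close>. The limit is
  \<open>pi / 2\<close> times the sign.\<close>

definition truncated_sgn :: "nat \<Rightarrow> real \<Rightarrow> real" where
  "truncated_sgn n x = (LBINT t:{1 / real (Suc n)..real (Suc n)}. sin (t * x) / t)"

text \<open>Rescaling the variable by \<open>\<bar>x\<bar>\<close> reduces each integral from 0 to
  the sine integral \<open>Si\<close>, whose boundedness and limit at infinity give the next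
  facts.\<close>

lemma truncated_sgn_eq:
  "truncated_sgn n x = sgn x * (Si (real (Suc n) * \<bar>x\<bar>) - Si (1 / real (Suc n) * \<bar>x\<bar>))"
proof -
  let ?f = "\<lambda>t. sin (t * x) / t"
  let ?a = "1 / real (Suc n)" and ?b = "real (Suc n)"
  have ab: "0 \<le> ?a" "?a \<le> ?b"
    by (auto simp: field_simps intro: order_trans[of _ 1])
  have "(LBINT t=ereal 0..ereal ?a. ?f t) + (LBINT t=ereal ?a..ereal ?b. ?f t) = (LBINT t=ereal 0..ereal ?b. ?f t)"
  proof (rule interval_integral_sum)
    have "min (ereal 0) (min (ereal ?a) (ereal ?b)) = ereal 0" "max (ereal 0) (max (ereal ?a) (ereal ?b)) = ereal ?b"
      using ab by (auto simp: min_def max_def)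
    then show "interval_lebesgue_integrable lborel (min (ereal 0) (min (ereal ?a) (ereal ?b)))
        (max (ereal 0) (max (ereal ?a) (ereal ?b))) ?f"
      using integrable_sinc'[of ?b x] by (simp only:)
  qed
  moreover have "(LBINT t=ereal ?a..ereal ?b. ?f t) = truncated_sgn n x"
    using ab unfolding truncated_sgn_def by (intro interval_integral_Icc) auto
  ultimately show ?thesis
    using LBINT_I0c_sin_scale_divide[of ?a x] LBINT_I0c_sin_scale_divide[of ?b x] ab
    by (simp add: zero_ereal_def algebra_simps)
qed

lemma borel_measurable_truncated_sgn [measurable]: "truncated_sgn n \<in> borel_measurable borel"
  unfolding truncated_sgn_eq[abs_def] by measurable

text \<open>Uniformity in \<open>n\<close> and \<open>x\<close> provides the constant dominating
  function for the passage to the limit under the expectation.\<close>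

lemma truncated_sgn_bounded: "\<exists>B. \<forall>n x. \<bar>truncated_sgn n x\<bar> \<le> B"
proof -
  obtain B where B: "\<And>T. \<bar>Si T\<bar> \<le> B" using bounded_Si by blast
  have "\<bar>truncated_sgn n x\<bar> \<le> 2 * B" for n x
  proof -
    have "\<bar>truncated_sgn n x\<bar> \<le> 1 * \<bar>Si (real (Suc n) * \<bar>x\<bar>) - Si (1 / real (Suc n) * \<bar>x\<bar>)\<bar>"
      unfolding truncated_sgn_eq abs_mult by (intro mult_right_mono) (auto simp: sgn_if)
    also have "\<dots> \<le> 2 * B"
      using B[of "real (Suc n) * \<bar>x\<bar>"] B[of "1 / real (Suc n) * \<bar>x\<bar>"]
        abs_triangle_ineq4[of "Si (real (Suc n) * \<bar>x\<bar>)" "Si (1 / real (Suc n) * \<bar>x\<bar>)"] by simp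
    finally show ?thesis .
  qed
  then show ?thesis by blast
qed

lemma truncated_sgn_tendsto: "(\<lambda>n. truncated_sgn n x) \<longlonglongrightarrow> sgn x * (pi / 2)"
proof (cases "x = 0")
  case True then show ?thesis by (simp add: truncated_sgn_eq)
next
  case False
  then have "filterlim (\<lambda>n. real (Suc n) * \<bar>x\<bar>) at_top sequentially"
    by real_asymp
  then have "(\<lambda>n. Si (real (Suc n) * \<bar>x\<bar>)) \<longlonglongrightarrow> pi / 2"
    by (rule filterlim_compose[OF Si_at_top])
  moreover have "(\<lambda>n. 1 / real (Suc n) * \<bar>x\<bar>) \<longlonglongrightarrow> 0 * \<bar>x\<bar>"
    by (intro tendsto_intros LIMSEQ_Suc[OF lim_1_over_n])
  then have "(\<lambda>n. Si (1 / real (Suc n) * \<bar>x\<bar>)) \<longlonglongrightarrow> Si 0"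
    using isCont_tendsto_compose[OF isCont_Si] by simp
  ultimately have "(\<lambda>n. sgn x * (Si (real (Suc n) * \<bar>x\<bar>) - Si (1 / real (Suc n) * \<bar>x\<bar>)))
      \<longlonglongrightarrow> sgn x * (pi / 2 - Si 0)"
    by (intro tendsto_intros)
  moreover have "Si 0 = 0" using Si_neg[of 0] by simp
  ultimately show ?thesis by (simp add: truncated_sgn_eq)
qed

section \<open>Expectation of a product of signs as a double integral\<close>

text \<open>Fubini on the product of the probability space with the square
  \<open>A n \<times> A n\<close>: the integrand is bounded by \<open>(Suc n)^2\<close> and
  supported on a set of finite measure.\<close>

lemma (in prob_space) expectation_truncated_sgn_mult:
  assumes [measurable]: "X \<in> borel_measurable M" "Y \<in> borel_measurable M"
  defines "A \<equiv> \<lambda>n. {1 / real (Suc n)..real (Suc n)}"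
  defines "G \<equiv> \<lambda>z. expectation (\<lambda>\<omega>. sin (fst z * X \<omega>) * sin (snd z * Y \<omega>)) / (fst z * snd z)"
  shows "integrable (lborel \<Otimes>\<^sub>M lborel) (\<lambda>z. indicator (A n \<times> A n) z * G z)"
    and "expectation (\<lambda>\<omega>. truncated_sgn n (X \<omega>) * truncated_sgn n (Y \<omega>)) =
      (\<integral>z. indicator (A n \<times> A n) z * G z \<partial>(lborel \<Otimes>\<^sub>M lborel))"
proof -
  let ?L = "lborel \<Otimes>\<^sub>M lborel :: (real \<times> real) measure"
  interpret L: pair_sigma_finite M ?L
    by (intro pair_sigma_finite.intro sigma_finite_measure_axioms lborel_pair.sigma_finite_measure_axioms)
  have [measurable]: "A n \<in> sets borel" by (simp add: A_def)
  define h where "h x t = indicator (A n) t * (sin (t * x) / t)" for x t :: real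
  have [measurable]: "case_prod h \<in> borel_measurable (borel \<Otimes>\<^sub>M borel)"
    unfolding h_def[abs_def] by measurable
  have h_bound: "\<bar>h x t\<bar> \<le> real (Suc n)" for x t
  proof (cases "t \<in> A n")
    case True
    then have t: "1 / real (Suc n) \<le> t" "0 < t"
      by (auto simp: A_def intro: less_le_trans[of 0 "1 / real (Suc n)"])
    have "\<bar>h x t\<bar> \<le> 1 / t" using t True by (auto simp: h_def divide_right_mono)
    also have "\<dots> \<le> real (Suc n)" using t by (simp add: field_simps)
    finally show ?thesis .
  qed (simp add: h_def)
  define f where "f \<omega> z = h (X \<omega>) (fst z) * h (Y \<omega>) (snd z)" for \<omega> z
  have f_meas [measurable]: "case_prod f \<in> borel_measurable (M \<Otimes>\<^sub>M ?L)"
    unfolding f_def[abs_def] by measurable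
  have fin: "emeasure (M \<Otimes>\<^sub>M ?L) (space M \<times> (A n \<times> A n)) < \<infinity>"
    by (simp add: lborel_pair.sigma_finite_measure_axioms sigma_finite_measure.emeasure_pair_measure_Times
        lborel.emeasure_pair_measure_Times A_def emeasure_space_1 ennreal_mult_less_top emeasure_lborel_Icc_eq)
  have f_int: "integrable (M \<Otimes>\<^sub>M ?L) (case_prod f)"
  proof (rule integrableI_bounded_set[where A = "space M \<times> (A n \<times> A n)" and B = "real (Suc n) * real (Suc n)"])
    have "\<bar>f \<omega> z\<bar> \<le> real (Suc n) * real (Suc n)" for \<omega> z
      unfolding f_def abs_mult by (intro mult_mono h_bound) auto
    then show "AE z in M \<Otimes>\<^sub>M ?L. z \<in> space M \<times> A n \<times> A n \<longrightarrow> norm (case z of (\<omega>, z) \<Rightarrow> f \<omega> z) \<le> real (Suc n) * real (Suc n)"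
      by auto
    show "AE z in M \<Otimes>\<^sub>M ?L. z \<notin> space M \<times> A n \<times> A n \<longrightarrow> (case z of (\<omega>, z) \<Rightarrow> f \<omega> z) = 0"
      by (intro AE_I2) (auto simp: f_def h_def space_pair_measure indicator_def)
  qed (use fin in auto)
  have trunc: "truncated_sgn n x = (\<integral>t. h x t \<partial>lborel)" for x
    by (simp add: truncated_sgn_def set_lebesgue_integral_def h_def A_def)
  have h_int: "integrable lborel (h x)" for x
  proof (rule integrableI_bounded_set[where A = "A n" and B = "real (Suc n)"])
    show "h x \<in> borel_measurable lborel" by measurable
    show "AE t in lborel. t \<in> A n \<longrightarrow> norm (h x t) \<le> real (Suc n)" using h_bound by auto
    show "AE t in lborel. t \<notin> A n \<longrightarrow> h x t = 0" by (auto simp: h_def)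
    show "emeasure lborel (A n) < \<infinity>" by (auto simp: A_def emeasure_lborel_Icc_eq)
  qed auto
  have prod: "truncated_sgn n x * truncated_sgn n y = (\<integral>z. h x (fst z) * h y (snd z) \<partial>?L)" for x y
  proof -
    have "integrable ?L (\<lambda>z. h x (fst z) * h y (snd z))"
      by (rule lborel_pair.Fubini_integrable) (use h_int in \<open>auto simp: abs_mult\<close>)
    then show ?thesis
      by (simp add: trunc lborel_pair.integral_fst'[symmetric])
  qed
  have inner: "(\<integral>\<omega>. f \<omega> z \<partial>M) = indicator (A n \<times> A n) z * G z" for z
  proof -
    have "f \<omega> z = indicator (A n \<times> A n) z / (fst z * snd z) * (sin (fst z * X \<omega>) * sin (snd z * Y \<omega>))" for \<omega>
      by (cases z) (auto simp: f_def h_def indicator_def)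
    then show ?thesis by (simp add: G_def)
  qed
  show "integrable ?L (\<lambda>z. indicator (A n \<times> A n) z * G z)"
    using L.integrable_snd[OF f_int] by (simp add: inner)
  have "expectation (\<lambda>\<omega>. truncated_sgn n (X \<omega>) * truncated_sgn n (Y \<omega>)) = (\<integral>\<omega>. (\<integral>z. f \<omega> z \<partial>?L) \<partial>M)"
    by (simp add: prod f_def)
  also have "\<dots> = (\<integral>z. (\<integral>\<omega>. f \<omega> z \<partial>M) \<partial>?L)"
    using L.Fubini_integral[OF f_int] by simp
  finally show "expectation (\<lambda>\<omega>. truncated_sgn n (X \<omega>) * truncated_sgn n (Y \<omega>)) =
      (\<integral>z. indicator (A n \<times> A n) z * G z \<partial>?L)"
    by (simp add: inner)
qed

text \<open>The two sides of the truncated identity pass to the limit differently: the expectation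
  by dominated convergence, the double integral by monotone convergence, since \<open>nonneg\<close>
  makes the truncated integrands increase. The factor \<open>pi\<^sup>2 / 4\<close> is the square of
  the Dirichlet value \<open>pi / 2\<close>.\<close>

lemma (in prob_space) expectation_sgn_mult:
  assumes [measurable]: "X \<in> borel_measurable M" "Y \<in> borel_measurable M"
    and nonneg: "\<And>t u. 0 < t \<Longrightarrow> 0 < u \<Longrightarrow> 0 \<le> expectation (\<lambda>\<omega>. sin (t * X \<omega>) * sin (u * Y \<omega>))"
  shows "ennreal (pi\<^sup>2 / 4 * expectation (\<lambda>\<omega>. sgn (X \<omega>) * sgn (Y \<omega>))) =
    (\<integral>\<^sup>+ z. ennreal (expectation (\<lambda>\<omega>. sin (fst z * X \<omega>) * sin (snd z * Y \<omega>)) / (fst z * snd z))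
       * indicator ({0<..} \<times> {0<..}) z \<partial>(lborel \<Otimes>\<^sub>M lborel))"
proof -
  let ?L = "lborel \<Otimes>\<^sub>M lborel :: (real \<times> real) measure"
  define G where "G z = expectation (\<lambda>\<omega>. sin (fst z * X \<omega>) * sin (snd z * Y \<omega>)) / (fst z * snd z)" for z
  define A where "A n = {1 / real (Suc n)..real (Suc n)}" for n
  have [measurable]: "A n \<in> sets borel" for n by (simp add: A_def)
  have G_meas [measurable]: "G \<in> borel_measurable ?L"
    unfolding G_def[abs_def] by measurable
  have A_pos: "t \<in> A n \<Longrightarrow> 0 < t" for t n
    by (auto simp: A_def intro: less_le_trans[of 0 "1 / real (Suc n)"])
  have ind_nonneg: "0 \<le> indicator (A n \<times> A n) z * G z" for n z
    by (auto simp: indicator_def G_def dest!: A_pos intro!: divide_nonneg_pos nonneg)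
  obtain B where B: "\<And>n x. \<bar>truncated_sgn n x\<bar> \<le> B" using truncated_sgn_bounded by blast
  have "(\<lambda>n. expectation (\<lambda>\<omega>. truncated_sgn n (X \<omega>) * truncated_sgn n (Y \<omega>)))
      \<longlonglongrightarrow> expectation (\<lambda>\<omega>. (sgn (X \<omega>) * (pi / 2)) * (sgn (Y \<omega>) * (pi / 2)))"
  proof (rule integral_dominated_convergence[where w = "\<lambda>_. B * B"])
    show "AE \<omega> in M. (\<lambda>n. truncated_sgn n (X \<omega>) * truncated_sgn n (Y \<omega>))
        \<longlonglongrightarrow> (sgn (X \<omega>) * (pi / 2)) * (sgn (Y \<omega>) * (pi / 2))"
      by (intro AE_I2 tendsto_mult truncated_sgn_tendsto)
    show "AE \<omega> in M. norm (truncated_sgn n (X \<omega>) * truncated_sgn n (Y \<omega>)) \<le> B * B" for n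
      using B order_trans[OF abs_ge_zero B]
      by (intro AE_I2) (auto simp: abs_mult intro!: mult_mono)
  qed auto
  also have "expectation (\<lambda>\<omega>. (sgn (X \<omega>) * (pi / 2)) * (sgn (Y \<omega>) * (pi / 2)))
      = expectation (\<lambda>\<omega>. pi\<^sup>2 / 4 * (sgn (X \<omega>) * sgn (Y \<omega>)))"
    by (intro Bochner_Integration.integral_cong) (auto simp: power2_eq_square)
  also have "\<dots> = pi\<^sup>2 / 4 * expectation (\<lambda>\<omega>. sgn (X \<omega>) * sgn (Y \<omega>))"
    by simp
  finally have lim1: "(\<lambda>n. ennreal (expectation (\<lambda>\<omega>. truncated_sgn n (X \<omega>) * truncated_sgn n (Y \<omega>))))
      \<longlonglongrightarrow> ennreal (pi\<^sup>2 / 4 * expectation (\<lambda>\<omega>. sgn (X \<omega>) * sgn (Y \<omega>)))"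
    by (rule tendsto_ennrealI)
  have eq: "ennreal (expectation (\<lambda>\<omega>. truncated_sgn n (X \<omega>) * truncated_sgn n (Y \<omega>)))
      = (\<integral>\<^sup>+ z. ennreal (indicator (A n \<times> A n) z * G z) \<partial>?L)" for n
    using expectation_truncated_sgn_mult[of X Y n] ind_nonneg[of n]
    by (simp add: nn_integral_eq_integral A_def G_def)
  have A_mono: "A m \<subseteq> A n" if "m \<le> n" for m n
    using that by (auto simp: A_def elim!: order_trans[rotated] intro: divide_left_mono)
  have A_Union: "\<exists>m. \<forall>n\<ge>m. t \<in> A n" if "0 < t" for t
  proof -
    \<comment> \<open>\<open>k\<close> bounds \<open>t\<close> from above and \<open>l\<close>
      bounds it away from 0, so the larger index serves both ends of the interval.\<close>
    obtain k where k: "t \<le> real k" using real_arch_simple by blast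
    obtain l where l: "1 / t \<le> real l" using real_arch_simple by blast
    have "1 / real (Suc (max k l)) \<le> 1 / (1 / t)"
      using l that by (intro divide_left_mono) (auto simp: max_def)
    then have "t \<in> A (max k l)"
      using k by (auto simp: A_def max_def)
    then show ?thesis using A_mono by blast
  qed
  have lim2: "(\<lambda>n. \<integral>\<^sup>+ z. ennreal (indicator (A n \<times> A n) z * G z) \<partial>?L)
      \<longlonglongrightarrow> (\<integral>\<^sup>+ z. ennreal (G z) * indicator ({0<..} \<times> {0<..}) z \<partial>?L)"
  proof (rule nn_integral_LIMSEQ)
    show "incseq (\<lambda>n z. ennreal (indicator (A n \<times> A n) z * G z))"
    proof (intro incseq_SucI le_funI ennreal_leI)
      fix n z
      show "indicator (A n \<times> A n) z * G z \<le> indicator (A (Suc n) \<times> A (Suc n)) z * G z"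
        using A_mono[of n "Suc n"] ind_nonneg[of "Suc n" z]
        by (cases "z \<in> A n \<times> A n") (auto simp: indicator_def)
    qed
    show "(\<lambda>n. ennreal (indicator (A n \<times> A n) z * G z)) \<longlonglongrightarrow> ennreal (G z) * indicator ({0<..} \<times> {0<..}) z" for z
    proof (cases "z \<in> {0<..} \<times> {0<..}")
      case True
      then obtain k l where "\<forall>n\<ge>k. fst z \<in> A n" "\<forall>n\<ge>l. snd z \<in> A n"
        using A_Union[of "fst z"] A_Union[of "snd z"] by auto
      then have "\<forall>\<^sub>F n in sequentially. ennreal (indicator (A n \<times> A n) z * G z) = ennreal (G z) * indicator ({0<..} \<times> {0<..}) z"
        using True by (intro eventually_sequentiallyI[of "max k l"]) (auto simp: indicator_def mem_Times_iff)
      then show ?thesis by (rule tendsto_eventually)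
    next
      case False
      then have "z \<notin> A n \<times> A n" for n using A_pos[of "fst z" n] A_pos[of "snd z" n] by (auto simp: mem_Times_iff)
      then show ?thesis using False by simp
    qed
  qed measurable
  show ?thesis
    using LIMSEQ_unique[OF lim1 lim2[folded eq]] by (simp add: G_def)
qed

section \<open>A logarithmic inequality and Frullani's integral\<close>

text \<open>Both sides depend only on \<open>r = b / a\<close> and agree at \<open>r = 1\<close>.
  Their difference \<open>h\<close> is nondecreasing for \<open>r \<ge> 1\<close>, because its
  derivative has the square \<open>(s - 1)\<^sup>2\<close> in the numerator.\<close>

lemma ln_ratio_le:
  fixes a b p q :: real
  assumes "0 < a" "a \<le> b" "0 < p" "0 \<le> q" "q \<le> p"
  shows "ln ((p * b + q * a) / (p * a + q * b)) \<le> (p - q) / (p + q) * ln (b / a)"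
proof -
  define h where "h r = (p - q) / (p + q) * ln r - ln (p * r + q) + ln (p + q * r)" for r
  define r where "r = b / a"
  have r: "1 \<le> r" using assms by (simp add: r_def)
  have "h 1 \<le> h r"
  proof (rule DERIV_nonneg_imp_nondecreasing[OF r])
    fix s :: real assume s: "1 \<le> s" "s \<le> r"
    have pos: "0 < p * s + q" "0 < p + q * s" "0 < p + q" "0 < s"
      using assms s by (auto intro: add_pos_nonneg)
    let ?d = "(p - q) / (p + q) * (1 / s) - p / (p * s + q) + q / (p + q * s)"
    have "(h has_real_derivative ?d) (at s)"
      unfolding h_def[abs_def] using pos by (auto intro!: derivative_eq_intros)
    moreover have "?d = (p - q) * (p * q * (s - 1)\<^sup>2) / ((p + q) * s * (p * s + q) * (p + q * s))"
      using pos by (simp add: divide_simps) (simp add: algebra_simps power2_eq_square)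
    moreover have "\<dots> \<ge> 0"
      using assms pos by (intro divide_nonneg_nonneg mult_nonneg_nonneg) auto
    ultimately show "\<exists>y. (h has_real_derivative y) (at s) \<and> 0 \<le> y" by metis
  qed
  moreover have "h 1 = 0" by (simp add: h_def)
  ultimately have "ln (p * r + q) - ln (p + q * r) \<le> (p - q) / (p + q) * ln r"
    by (simp add: h_def)
  moreover have "ln (p * r + q) - ln (p + q * r) = ln ((p * r + q) / (p + q * r))"
  proof -
    have "0 < p * r + q" "0 < p + q * r" using assms r by (auto intro: add_pos_nonneg)
    then show ?thesis by (simp add: ln_div)
  qed
  moreover have "(p * r + q) / (p + q * r) = (p * b + q * a) / (p * a + q * b)"
  proof -
    have "b = r * a" using assms by (simp add: r_def)
    then have "p * b + q * a = (p * r + q) * a" "p * a + q * b = (p + q * r) * a"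
      by (simp_all add: algebra_simps)
    then show ?thesis using assms by simp
  qed
  ultimately show ?thesis by (simp add: r_def)
qed

text \<open>The integrand has the explicit antiderivative \<open>?F\<close>, so the value is read
  off from its limits at 0 and at infinity.\<close>

lemma nn_integral_powr_exp:
  fixes \<alpha> k :: real
  assumes "0 < \<alpha>" "0 < k"
  shows "(\<integral>\<^sup>+ t. ennreal (t powr (\<alpha> - 1) * exp (- (k * t powr \<alpha>))) * indicator {0<..} t \<partial>lborel) = ennreal (1 / (\<alpha> * k))"
proof -
  let ?f = "\<lambda>t. t powr (\<alpha> - 1) * exp (- (k * t powr \<alpha>))"
  let ?F = "\<lambda>t. - exp (- (k * t powr \<alpha>)) / (\<alpha> * k)"
  have F: "(?F has_real_derivative ?f t) (at t)" if "0 < t" for t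
    using that assms
    by (auto intro!: derivative_eq_intros simp: powr_diff)
  have lim0: "((?F \<circ> real_of_ereal) \<longlongrightarrow> - 1 / (\<alpha> * k)) (at_right 0)"
    unfolding zero_ereal_def ereal_tendsto_simps
    using assms by (real_asymp simp: field_simps)
  have lim_top: "((?F \<circ> real_of_ereal) \<longlongrightarrow> 0) (at_left \<infinity>)"
    unfolding ereal_tendsto_simps using assms by real_asymp
  have int: "set_integrable lborel (einterval 0 \<infinity>) ?f"
    and val: "(LBINT t=0..\<infinity>. ?f t) = 0 - (- 1 / (\<alpha> * k))"
  proof -
    have cont: "isCont ?f t" if "0 < t" for t
      using that by (intro continuous_intros) auto
    note FTC = interval_integral_FTC_nonneg[where f = ?f, OF _ _ _ _ lim0 lim_top]
    show "set_integrable lborel (einterval 0 \<infinity>) ?f" "(LBINT t=0..\<infinity>. ?f t) = 0 - (- 1 / (\<alpha> * k))"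
      by (rule FTC; use F cont in \<open>simp add: zero_ereal_def\<close>)+
  qed
  have "(\<integral>\<^sup>+ t. ennreal (?f t) * indicator {0<..} t \<partial>lborel) = (\<integral>\<^sup>+ t. ennreal (indicator {0<..} t *\<^sub>R ?f t) \<partial>lborel)"
    by (intro nn_integral_cong) (auto simp: indicator_def)
  also have "\<dots> = ennreal (\<integral>t. indicator {0<..} t *\<^sub>R ?f t \<partial>lborel)"
    using int by (intro nn_integral_eq_integral) (auto simp: set_integrable_def zero_ereal_def)
  also have "(\<integral>t. indicator {0<..} t *\<^sub>R ?f t \<partial>lborel) = 1 / (\<alpha> * k)"
    using val by (simp add: interval_lebesgue_integral_0_infty set_lebesgue_integral_def)
  finally show ?thesis .
qed

text \<open>The difference of exponentials, divided by \<open>t\<close>, is the integral over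
  \<open>k\<close> from \<open>k1\<close> to \<open>k2\<close> of the integrand of
  \<open>nn_integral_powr_exp\<close>. Tonelli then leaves the integral of
  \<open>1 / (\<alpha> * k)\<close>.\<close>

lemma frullani_exp_powr:
  fixes \<alpha> k1 k2 :: real
  assumes "0 < \<alpha>" "0 < k1" "k1 \<le> k2"
  shows "(\<integral>\<^sup>+ t. ennreal ((exp (- (k1 * t powr \<alpha>)) - exp (- (k2 * t powr \<alpha>))) / t) * indicator {0<..} t \<partial>lborel)
    = ennreal (ln (k2 / k1) / \<alpha>)"
proof -
  let ?g = "\<lambda>t k. ennreal (t powr (\<alpha> - 1) * exp (- (k * t powr \<alpha>))) * indicator {0<..} t * indicator {k1..k2} k"
  have "(\<integral>\<^sup>+ t. ennreal ((exp (- (k1 * t powr \<alpha>)) - exp (- (k2 * t powr \<alpha>))) / t) * indicator {0<..} t \<partial>lborel)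
      = (\<integral>\<^sup>+ t. (\<integral>\<^sup>+ k. ?g t k \<partial>lborel) \<partial>lborel)"
  proof (intro nn_integral_cong)
    fix t :: real
    show "ennreal ((exp (- (k1 * t powr \<alpha>)) - exp (- (k2 * t powr \<alpha>))) / t) * indicator {0<..} t = (\<integral>\<^sup>+ k. ?g t k \<partial>lborel)"
    proof (cases "0 < t")
      case True
      have "(\<integral>\<^sup>+ k. ennreal (t powr (\<alpha> - 1) * exp (- (k * t powr \<alpha>))) * indicator {k1..k2} k \<partial>lborel)
          = - exp (- (k2 * t powr \<alpha>)) / t - (- exp (- (k1 * t powr \<alpha>)) / t)"
        using assms True
        by (intro nn_integral_FTC_Icc) (auto intro!: derivative_eq_intros simp: powr_diff)
      then show ?thesis using True by (simp add: diff_divide_distrib)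
    qed simp
  qed
  also have "\<dots> = (\<integral>\<^sup>+ k. (\<integral>\<^sup>+ t. ?g t k \<partial>lborel) \<partial>lborel)"
    by (intro lborel_pair.Fubini') measurable
  also have "\<dots> = (\<integral>\<^sup>+ k. ennreal (1 / (\<alpha> * k)) * indicator {k1..k2} k \<partial>lborel)"
    using assms by (intro nn_integral_cong) (auto simp: nn_integral_multc nn_integral_powr_exp split: split_indicator)
  also have "\<dots> = ennreal (ln k2 / \<alpha> - ln k1 / \<alpha>)"
    using assms by (intro nn_integral_FTC_Icc) (auto intro!: derivative_eq_intros)
  also have "ln k2 / \<alpha> - ln k1 / \<alpha> = ln (k2 / k1) / \<alpha>"
    using assms by (simp add: ln_div diff_divide_distrib)
  finally show ?thesis .
qed

section \<open>The kernel of the double integral and its dependence on \<open>q\<close>\<close>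

text \<open>This is twice the expectation of \<open>sin (t * (Y - S)) * sin (u * (Y + S))\<close>
  when \<open>(Y, S)\<close> has the joint characteristic function with parameters \<open>p\<close>
  and \<open>q\<close>, by the product-to-sum formula.\<close>

definition stable_kernel :: "real \<Rightarrow> real \<Rightarrow> real \<Rightarrow> real \<Rightarrow> real \<Rightarrow> real" where
  "stable_kernel \<alpha> p q t u =
     exp (- (p * \<bar>t - u\<bar> powr \<alpha> + q * \<bar>t + u\<bar> powr \<alpha>)) - exp (- (p * \<bar>t + u\<bar> powr \<alpha> + q * \<bar>t - u\<bar> powr \<alpha>))"

lemma borel_measurable_stable_kernel [measurable (raw)]:
  assumes [measurable]: "f \<in> borel_measurable M" "g \<in> borel_measurable M"
  shows "(\<lambda>z. stable_kernel \<alpha> p q (f z) (g z)) \<in> borel_measurable M"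
  unfolding stable_kernel_def by measurable

lemma rearrangement_ineq_two:
  fixes p q a b :: real
  assumes "q \<le> p" "a \<le> b"
  shows "p * a + q * b \<le> p * b + q * a"
proof -
  have "0 \<le> (p - q) * (b - a)" using assms by simp
  then show ?thesis by (simp add: algebra_simps)
qed

lemma stable_kernel_nonneg:
  assumes "0 < \<alpha>" "q \<le> p" "0 < t" "0 < u"
  shows "0 \<le> stable_kernel \<alpha> p q t u"
proof -
  have "\<bar>t - u\<bar> powr \<alpha> \<le> \<bar>t + u\<bar> powr \<alpha>"
    using assms by (intro powr_mono2) auto
  from rearrangement_ineq_two[OF assms(2) this] show ?thesis
    by (simp add: stable_kernel_def)
qed

text \<open>Taking values in \<open>ennreal\<close> allows Tonelli and monotonicity to be applied
  before finiteness is known.\<close>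

definition stable_kernel_integral :: "real \<Rightarrow> real \<Rightarrow> real \<Rightarrow> ennreal" where
  "stable_kernel_integral \<alpha> p q = (\<integral>\<^sup>+ z. ennreal (stable_kernel \<alpha> p q (fst z) (snd z) / (fst z * snd z))
      * indicator ({0<..} \<times> {0<..}) z \<partial>(lborel \<Otimes>\<^sub>M lborel))"

text \<open>Under \<open>u = t * v\<close> each power splits off \<open>t powr \<alpha>\<close>, so
  for fixed \<open>v\<close> the kernel is a difference of exponentials with rates
  \<open>k1 v \<le> k2 v\<close>. Exchanging the integrals makes the one over \<open>t\<close> a
  Frullani integral.\<close>

lemma stable_kernel_integral_eq:
  assumes "0 < \<alpha>" "0 < p" "0 \<le> q" "q \<le> p"
  shows "stable_kernel_integral \<alpha> p q = (\<integral>\<^sup>+ v. ennreal (ln ((p * (1 + v) powr \<alpha> + q * \<bar>1 - v\<bar> powr \<alpha>) /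
      (p * \<bar>1 - v\<bar> powr \<alpha> + q * (1 + v) powr \<alpha>)) / (\<alpha> * v)) * indicator {0<..} v \<partial>lborel)"
proof -
  define a where "a v = \<bar>1 - v\<bar> powr \<alpha>" for v :: real
  define b where "b v = \<bar>1 + v\<bar> powr \<alpha>" for v :: real
  define k1 where "k1 v = p * a v + q * b v" for v
  define k2 where "k2 v = p * b v + q * a v" for v
  let ?e = "\<lambda>t v. ennreal ((exp (- (k1 v * t powr \<alpha>)) - exp (- (k2 v * t powr \<alpha>))) / t) * indicator {0<..} t
      * (ennreal (1 / v) * indicator {0<..} v)"
  have [measurable]: "a \<in> borel_measurable borel" "b \<in> borel_measurable borel"
    unfolding a_def[abs_def] b_def[abs_def] by measurable
  then have [measurable]: "k1 \<in> borel_measurable borel" "k2 \<in> borel_measurable borel"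
    unfolding k1_def[abs_def] k2_def[abs_def] by measurable
  have ab: "0 \<le> a v" "a v \<le> b v" if "0 < v" for v
    using that assms by (auto simp: a_def b_def intro!: powr_mono2)
  have k12: "k1 v \<le> k2 v" if "0 < v" for v
    using rearrangement_ineq_two[OF assms(4) ab(2)[OF that]] by (simp add: k1_def k2_def)
  \<comment> \<open>For \<open>q = 0\<close> the rate \<open>k1\<close> vanishes at
    \<open>v = 1\<close>; this null set is discarded below.\<close>
  have k1_pos: "0 < k1 v" if "0 < v" "v \<noteq> 1" for v
    using that assms by (auto simp: k1_def a_def b_def intro!: add_pos_nonneg mult_pos_pos)
  have kernel: "stable_kernel \<alpha> p q t (t * v) = exp (- (k1 v * t powr \<alpha>)) - exp (- (k2 v * t powr \<alpha>))" if "0 < t" for t v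
  proof -
    have "t - t * v = t * (1 - v)" "t + t * v = t * (1 + v)"
      by (simp_all add: algebra_simps)
    then have "\<bar>t - t * v\<bar> = t * \<bar>1 - v\<bar>" "\<bar>t + t * v\<bar> = t * \<bar>1 + v\<bar>"
      using that by (simp_all only: abs_mult abs_of_pos)
    then show ?thesis
      using that by (simp add: stable_kernel_def powr_mult k1_def k2_def a_def b_def algebra_simps)
  qed
  let ?g = "\<lambda>z. ennreal (stable_kernel \<alpha> p q (fst z) (snd z) / (fst z * snd z)) * indicator ({0<..} \<times> {0<..}) z"
  have "stable_kernel_integral \<alpha> p q = (\<integral>\<^sup>+ t. (\<integral>\<^sup>+ u. ?g (t, u) \<partial>lborel) \<partial>lborel)"
    unfolding stable_kernel_integral_def by (subst lborel.nn_integral_fst) auto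
  also have "\<dots> = (\<integral>\<^sup>+ t. (\<integral>\<^sup>+ v. ?e t v \<partial>lborel) \<partial>lborel)"
  proof (rule nn_integral_cong)
    fix t :: real
    show "(\<integral>\<^sup>+ u. ?g (t, u) \<partial>lborel) = (\<integral>\<^sup>+ v. ?e t v \<partial>lborel)"
    proof (cases "0 < t")
      case True
      \<comment> \<open>The Jacobian \<open>\<bar>t\<bar>\<close> cancels one of the two factors
        \<open>t\<close> in the denominator \<open>t * (t * v)\<close>, leaving \<open>1 / t\<close>
        for Frullani and \<open>1 / v\<close> outside.\<close>
      have "(\<integral>\<^sup>+ u. ?g (t, u) \<partial>lborel) = ennreal \<bar>t\<bar> * (\<integral>\<^sup>+ v. ?g (t, 0 + t * v) \<partial>lborel)"
        using True by (intro nn_integral_real_affine) auto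
      also have "\<dots> = (\<integral>\<^sup>+ v. ennreal \<bar>t\<bar> * ?g (t, 0 + t * v) \<partial>lborel)"
        by (intro nn_integral_cmult[symmetric]) simp
      also have "\<dots> = (\<integral>\<^sup>+ v. ?e t v \<partial>lborel)"
      proof (intro nn_integral_cong)
        fix v :: real
        show "ennreal \<bar>t\<bar> * ?g (t, 0 + t * v) = ?e t v"
        proof (cases "0 < v")
          case v: True
          let ?d = "exp (- (k1 v * t powr \<alpha>)) - exp (- (k2 v * t powr \<alpha>))"
          have d: "0 \<le> ?d" using k12[OF v] by (simp add: mult_right_mono)
          have "ennreal \<bar>t\<bar> * ?g (t, 0 + t * v) = ennreal (\<bar>t\<bar> * (?d / (t * (t * v))))"
            using True v d by (subst ennreal_mult) (auto simp: kernel)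
          also have "\<bar>t\<bar> * (?d / (t * (t * v))) = ?d / t * (1 / v)"
            using True v by (simp add: field_simps)
          also have "ennreal \<dots> = ?e t v"
            using True v d by (subst ennreal_mult) auto
          finally show ?thesis .
        qed (use True in \<open>simp add: zero_less_mult_iff\<close>)
      qed
      finally show ?thesis .
    next
      case False
      then have "?g (t, u) = 0" "?e t u = 0" for u by (auto simp: indicator_def)
      then show ?thesis by (simp only:)
    qed
  qed
  also have "\<dots> = (\<integral>\<^sup>+ v. (\<integral>\<^sup>+ t. ?e t v \<partial>lborel) \<partial>lborel)"
    by (intro lborel_pair.Fubini') measurable
  also have "\<dots> = (\<integral>\<^sup>+ v. ennreal (ln (k2 v / k1 v) / (\<alpha> * v)) * indicator {0<..} v \<partial>lborel)"
  proof (rule nn_integral_cong_AE, use AE_lborel_singleton[of 1] in eventually_elim)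
    fix v :: real assume "v \<noteq> 1"
    show "(\<integral>\<^sup>+ t. ?e t v \<partial>lborel) = ennreal (ln (k2 v / k1 v) / (\<alpha> * v)) * indicator {0<..} v"
    proof (cases "0 < v")
      case True
      have "0 \<le> ln (k2 v / k1 v)"
        using k1_pos[OF True \<open>v \<noteq> 1\<close>] k12[OF True] by simp
      then show ?thesis
        using True assms k1_pos[OF True \<open>v \<noteq> 1\<close>] k12[OF True]
        by (simp add: nn_integral_multc frullani_exp_powr flip: ennreal_mult)
    qed simp
  qed
  also have "\<dots> = (\<integral>\<^sup>+ v. ennreal (ln ((p * (1 + v) powr \<alpha> + q * \<bar>1 - v\<bar> powr \<alpha>) /
      (p * \<bar>1 - v\<bar> powr \<alpha> + q * (1 + v) powr \<alpha>)) / (\<alpha> * v)) * indicator {0<..} v \<partial>lborel)"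
    by (intro nn_integral_cong) (auto simp: k1_def k2_def a_def b_def indicator_def)
  finally show ?thesis .
qed

text \<open>At \<open>q = 0\<close> the logarithm is exactly \<open>ln (b / a)\<close>, so the
  pointwise bound \<open>ln_ratio_le\<close> compares the two integrands with a factor independent
  of \<open>v\<close>.\<close>

lemma stable_kernel_integral_le:
  assumes "0 < \<alpha>" "0 < p" "0 \<le> q" "q \<le> p"
  shows "stable_kernel_integral \<alpha> p q \<le> ennreal ((p - q) / (p + q)) * stable_kernel_integral \<alpha> p 0"
proof -
  have c: "0 \<le> (p - q) / (p + q)" using assms by simp
  show ?thesis
    unfolding stable_kernel_integral_eq[OF assms] stable_kernel_integral_eq[OF assms(1,2) order.refl less_imp_le[OF assms(2)]]
  proof (subst nn_integral_cmult[symmetric], measurable, rule nn_integral_mono_AE, use AE_lborel_singleton[of 1] in eventually_elim)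
    \<comment> \<open>At \<open>v = 1\<close> the smaller power \<open>?a\<close> is 0, outside the
      range of \<open>ln_ratio_le\<close>.\<close>
    fix v :: real assume v: "v \<noteq> 1"
    let ?a = "\<bar>1 - v\<bar> powr \<alpha>" and ?b = "(1 + v) powr \<alpha>"
    show "ennreal (ln ((p * ?b + q * ?a) / (p * ?a + q * ?b)) / (\<alpha> * v)) * indicator {0<..} v
      \<le> ennreal ((p - q) / (p + q)) * (ennreal (ln ((p * ?b + 0 * ?a) / (p * ?a + 0 * ?b)) / (\<alpha> * v)) * indicator {0<..} v)"
    proof (cases "0 < v")
      case True
      have ab: "0 < ?a" "?a \<le> ?b" using v True assms by (auto intro!: powr_mono2)
      have "ln ((p * ?b + q * ?a) / (p * ?a + q * ?b)) / (\<alpha> * v) \<le> (p - q) / (p + q) * ln (?b / ?a) / (\<alpha> * v)"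
        using assms True by (intro divide_right_mono ln_ratio_le ab) auto
      also have "\<dots> = (p - q) / (p + q) * (ln ((p * ?b + 0 * ?a) / (p * ?a + 0 * ?b)) / (\<alpha> * v))"
        using assms by simp
      finally show ?thesis
        using True c ab assms by (simp add: ennreal_leI flip: ennreal_mult')
    qed simp
  qed
qed

section \<open>The probability that one stable variable dominates another\<close>

lemma (in prob_space) expectation_sgn_sum_diff:
  assumes [measurable]: "Y \<in> borel_measurable M" "S \<in> borel_measurable M"
    and cf: "\<And>t u. expectation (\<lambda>\<omega>. cos (t * Y \<omega> + u * S \<omega>)) = exp (- (p * \<bar>t\<bar> powr \<alpha> + q * \<bar>u\<bar> powr \<alpha>))"
    and "0 < \<alpha>" "q \<le> p"
  shows "ennreal (pi\<^sup>2 / 2 * expectation (\<lambda>\<omega>. sgn (Y \<omega> - S \<omega>) * sgn (Y \<omega> + S \<omega>))) = stable_kernel_integral \<alpha> p q"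
proof -
  have int: "integrable M (\<lambda>\<omega>. cos (t * Y \<omega> + u * S \<omega>))" for t u
    by (rule integrable_const_bound[where B = 1]) auto
  have eq: "expectation (\<lambda>\<omega>. sin (t * (Y \<omega> - S \<omega>)) * sin (u * (Y \<omega> + S \<omega>))) = stable_kernel \<alpha> p q t u / 2" for t u
  proof -
    \<comment> \<open>The cosine arguments are regrouped by \<open>Y\<close> and \<open>S\<close>,
      so that \<open>cf\<close> attaches \<open>p\<close> to the first coefficient and
      \<open>q\<close> to the second.\<close>
    have "sin (t * (Y \<omega> - S \<omega>)) * sin (u * (Y \<omega> + S \<omega>)) =
        (cos ((t - u) * Y \<omega> + (- (t + u)) * S \<omega>) - cos ((t + u) * Y \<omega> + (u - t) * S \<omega>)) / 2" for \<omega>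
      by (simp add: sin_times_sin algebra_simps)
    then have "expectation (\<lambda>\<omega>. sin (t * (Y \<omega> - S \<omega>)) * sin (u * (Y \<omega> + S \<omega>))) =
        (expectation (\<lambda>\<omega>. cos ((t - u) * Y \<omega> + (- (t + u)) * S \<omega>)) -
         expectation (\<lambda>\<omega>. cos ((t + u) * Y \<omega> + (u - t) * S \<omega>))) / 2"
      by (simp only: Bochner_Integration.integral_diff[OF int int] integral_divide_zero)
    then show ?thesis
      by (simp only: cf stable_kernel_def abs_minus_cancel abs_minus_commute[of u t])
  qed
  have "ennreal (pi\<^sup>2 / 4 * expectation (\<lambda>\<omega>. sgn (Y \<omega> - S \<omega>) * sgn (Y \<omega> + S \<omega>))) =
      (\<integral>\<^sup>+ z. ennreal (1 / 2) * (ennreal (stable_kernel \<alpha> p q (fst z) (snd z) / (fst z * snd z))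
       * indicator ({0<..} \<times> {0<..}) z) \<partial>(lborel \<Otimes>\<^sub>M lborel))"
  proof (subst expectation_sgn_mult)
    show "0 \<le> expectation (\<lambda>\<omega>. sin (t * (Y \<omega> - S \<omega>)) * sin (u * (Y \<omega> + S \<omega>)))" if "0 < t" "0 < u" for t u
      using that assms stable_kernel_nonneg by (simp add: eq)
    have "ennreal (stable_kernel \<alpha> p q t u / 2 / (t * u)) = ennreal (1 / 2) * ennreal (stable_kernel \<alpha> p q t u / (t * u))" for t u
      by (subst ennreal_mult'[symmetric]) (auto simp: mult.commute)
    then show "(\<integral>\<^sup>+ z. ennreal (expectation (\<lambda>\<omega>. sin (fst z * (Y \<omega> - S \<omega>)) * sin (snd z * (Y \<omega> + S \<omega>))) / (fst z * snd z))
        * indicator ({0<..} \<times> {0<..}) z \<partial>(lborel \<Otimes>\<^sub>M lborel)) =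
      (\<integral>\<^sup>+ z. ennreal (1 / 2) * (ennreal (stable_kernel \<alpha> p q (fst z) (snd z) / (fst z * snd z))
        * indicator ({0<..} \<times> {0<..}) z) \<partial>(lborel \<Otimes>\<^sub>M lborel))"
      by (simp only: eq mult.assoc)
  qed auto
  also have "\<dots> = ennreal (1 / 2) * stable_kernel_integral \<alpha> p q"
    unfolding stable_kernel_integral_def by (intro nn_integral_cmult) measurable
  \<comment> \<open>Doubling removes the factor 1/2 of the product-to-sum formula and turns
    \<open>pi\<^sup>2 / 4\<close> into \<open>pi\<^sup>2 / 2\<close>.\<close>
  finally have "ennreal 2 * ennreal (pi\<^sup>2 / 4 * expectation (\<lambda>\<omega>. sgn (Y \<omega> - S \<omega>) * sgn (Y \<omega> + S \<omega>)))
      = (ennreal 2 * ennreal (1 / 2)) * stable_kernel_integral \<alpha> p q"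
    by (simp only: mult.assoc)
  moreover have "ennreal 2 * ennreal (1 / 2) = 1"
    by (subst ennreal_mult[symmetric]) auto
  moreover have "ennreal 2 * ennreal (pi\<^sup>2 / 4 * expectation (\<lambda>\<omega>. sgn (Y \<omega> - S \<omega>) * sgn (Y \<omega> + S \<omega>)))
     = ennreal (pi\<^sup>2 / 2 * expectation (\<lambda>\<omega>. sgn (Y \<omega> - S \<omega>) * sgn (Y \<omega> + S \<omega>)))"
    by (subst ennreal_mult'[symmetric]) auto
  ultimately show ?thesis by simp
qed

text \<open>The kernel integral at \<open>q = 0\<close> is never evaluated: it is itself an
  expectation of signs times \<open>pi\<^sup>2 / 2\<close>, hence at most that constant, and the
  constant cancels.\<close>

lemma (in prob_space) prob_abs_less_stable:
  assumes [measurable]: "Y \<in> borel_measurable M" "S \<in> borel_measurable M"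
    and cf: "\<And>t u. expectation (\<lambda>\<omega>. cos (t * Y \<omega> + u * S \<omega>)) = exp (- (p * \<bar>t\<bar> powr \<alpha> + q * \<bar>u\<bar> powr \<alpha>))"
    and "0 < \<alpha>" "0 < p" "0 \<le> q" "q \<le> p"
  shows "prob {\<omega> \<in> space M. \<bar>S \<omega>\<bar> < \<bar>Y \<omega>\<bar>} \<le> p / (p + q)"
proof -
  let ?E = "expectation (\<lambda>\<omega>. sgn (Y \<omega> - S \<omega>) * sgn (Y \<omega> + S \<omega>))"
  have sgn_int: "integrable M (\<lambda>\<omega>. sgn (f \<omega>) * sgn (g \<omega>))"
    if [measurable]: "f \<in> borel_measurable M" "g \<in> borel_measurable M" for f g :: "'a \<Rightarrow> real"
    by (rule integrable_const_bound[where B = 1]) (auto simp: sgn_if)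
  \<comment> \<open>the degenerate case \<open>S = 0\<close> normalises the kernel integral\<close>
  have "stable_kernel_integral \<alpha> p 0 = ennreal (pi\<^sup>2 / 2 * expectation (\<lambda>\<omega>. sgn (Y \<omega> - 0) * sgn (Y \<omega> + 0)))"
    using assms cf[of _ 0] by (intro expectation_sgn_sum_diff[symmetric]) auto
  also have "\<dots> \<le> ennreal (pi\<^sup>2 / 2 * 1)"
  proof (intro ennreal_leI mult_left_mono)
    have "expectation (\<lambda>\<omega>. sgn (Y \<omega> - 0) * sgn (Y \<omega> + 0)) \<le> expectation (\<lambda>_. 1)"
      by (intro integral_mono sgn_int) (auto simp: sgn_if)
    then show "expectation (\<lambda>\<omega>. sgn (Y \<omega> - 0) * sgn (Y \<omega> + 0)) \<le> 1"
      by (simp add: prob_space)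
  qed simp
  finally have base: "stable_kernel_integral \<alpha> p 0 \<le> ennreal (pi\<^sup>2 / 2)" by simp
  have "ennreal (pi\<^sup>2 / 2 * ?E) = stable_kernel_integral \<alpha> p q"
    using assms by (intro expectation_sgn_sum_diff) auto
  also have "\<dots> \<le> ennreal ((p - q) / (p + q)) * stable_kernel_integral \<alpha> p 0"
    using assms by (intro stable_kernel_integral_le) auto
  also have "\<dots> \<le> ennreal ((p - q) / (p + q)) * ennreal (pi\<^sup>2 / 2)"
    by (intro mult_left_mono base) simp
  also have "\<dots> = ennreal ((p - q) / (p + q) * (pi\<^sup>2 / 2))"
    using assms by (subst ennreal_mult) auto
  \<comment> \<open>Returning from \<open>ennreal\<close> to the reals requires the right side to be
    nonnegative, which is where \<open>q \<le> p\<close> enters; \<open>?E\<close> may have either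
    sign.\<close>
  finally have "pi\<^sup>2 / 2 * ?E \<le> (p - q) / (p + q) * (pi\<^sup>2 / 2)"
    using assms by (subst (asm) ennreal_le_iff) auto
  then have "pi\<^sup>2 / 2 * ?E \<le> pi\<^sup>2 / 2 * ((p - q) / (p + q))" by (simp only: mult.commute)
  then have E: "?E \<le> (p - q) / (p + q)" by (rule mult_left_le_imp_le) simp
  have "prob {\<omega> \<in> space M. \<bar>S \<omega>\<bar> < \<bar>Y \<omega>\<bar>} = expectation (indicator {\<omega> \<in> space M. \<bar>S \<omega>\<bar> < \<bar>Y \<omega>\<bar>})"
    by simp
  also have "\<dots> \<le> expectation (\<lambda>\<omega>. (1 + sgn (Y \<omega> - S \<omega>) * sgn (Y \<omega> + S \<omega>)) / 2)"
  proof (rule integral_mono)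
    show "integrable M (\<lambda>\<omega>. (1 + sgn (Y \<omega> - S \<omega>) * sgn (Y \<omega> + S \<omega>)) / 2)"
      by (intro integrable_divide Bochner_Integration.integrable_add sgn_int integrable_const) auto
    \<comment> \<open>The product of signs is the sign of \<open>Y\<^sup>2 - S\<^sup>2\<close>. The
      two sides agree except at ties, where the right side is 1/2.\<close>
    show "indicator {\<omega> \<in> space M. \<bar>S \<omega>\<bar> < \<bar>Y \<omega>\<bar>} \<omega> \<le> (1 + sgn (Y \<omega> - S \<omega>) * sgn (Y \<omega> + S \<omega>)) / 2" for \<omega>
      by (auto simp: indicator_def sgn_if abs_if split: if_splits)
  qed (auto simp: less_top[symmetric])
  also have "\<dots> = (1 + ?E) / 2"
    by (simp add: sgn_int prob_space)
  also have "\<dots> \<le> (1 + (p - q) / (p + q)) / 2" using E by (intro divide_right_mono add_left_mono) auto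
  also have "\<dots> = p / (p + q)" using assms by (simp add: field_simps)
  finally show ?thesis .
qed

section \<open>Linear combinations of stable variables and the estimator\<close>

text \<open>The expectation is the real part of the characteristic function of the sum at 1, which
  factors by independence; the coefficients \<open>z i\<close> take over the role of the
  arguments.\<close>

lemma (in prob_space) expectation_cos_sum_stable:
  fixes X :: "'b \<Rightarrow> 'a \<Rightarrow> real"
  assumes indep: "indep_vars (\<lambda>_. borel) X I"
    and law: "\<And>i. i \<in> I \<Longrightarrow> sas_law \<alpha> (distr M borel (X i))"
  shows "expectation (\<lambda>\<omega>. cos (\<Sum>i\<in>I. z i * X i \<omega>)) = exp (- (\<Sum>i\<in>I. \<bar>z i\<bar> powr \<alpha>))"
proof -
  have [measurable]: "X i \<in> borel_measurable M" if "i \<in> I" for i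
    using indep that by (auto simp: indep_vars_def)
  have "char (distr M borel (\<lambda>\<omega>. \<Sum>i\<in>I. z i * X i \<omega>)) 1 = (\<Prod>i\<in>I. char (distr M borel (\<lambda>\<omega>. z i * X i \<omega>)) 1)"
    by (intro char_distr_sum indep_vars_compose2[OF indep, where Y = "\<lambda>i x. z i * x"]) auto
  also have "\<dots> = (\<Prod>i\<in>I. complex_of_real (exp (- (\<bar>z i\<bar> powr \<alpha>))))"
  proof (rule prod.cong[OF refl])
    fix i assume i: "i \<in> I"
    note [measurable] = \<open>i \<in> I\<close>
    have "char (distr M borel (\<lambda>\<omega>. z i * X i \<omega>)) 1 = char (distr M borel (X i)) (z i)"
      using i by (simp add: char_def integral_distr)
    then show "char (distr M borel (\<lambda>\<omega>. z i * X i \<omega>)) 1 = complex_of_real (exp (- (\<bar>z i\<bar> powr \<alpha>)))"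
      using law[OF i] by (simp add: sas_law_def)
  qed
  \<comment> \<open>For infinite \<open>I\<close> the product is 1 and the sum is 0 by convention,
    so the equation persists.\<close>
  also have "\<dots> = complex_of_real (exp (- (\<Sum>i\<in>I. \<bar>z i\<bar> powr \<alpha>)))"
    by (cases "finite I") (simp_all add: exp_sum flip: of_real_prod sum_negf)
  finally have "Re (char (distr M borel (\<lambda>\<omega>. \<Sum>i\<in>I. z i * X i \<omega>)) 1) = exp (- (\<Sum>i\<in>I. \<bar>z i\<bar> powr \<alpha>))"
    by simp
  moreover have "Re (char (distr M borel (\<lambda>\<omega>. \<Sum>i\<in>I. z i * X i \<omega>)) 1) = expectation (\<lambda>\<omega>. cos (\<Sum>i\<in>I. z i * X i \<omega>))"
  proof -
    have "integrable M (\<lambda>\<omega>. iexp (\<Sum>i\<in>I. z i * X i \<omega>))"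
      by (rule integrable_const_bound[where B = 1]) auto
    then show ?thesis
      by (simp add: char_def integral_distr integral_Re[symmetric] Re_exp)
  qed
  ultimately show ?thesis by simp
qed

lemma xhat_min_gt_iff:
  assumes "0 < M"
  shows "\<epsilon> < \<bar>xhat_min N M x s i \<omega>\<bar> \<longleftrightarrow> (\<forall>j<M. \<epsilon> < \<bar>meas N x s j \<omega> / s i j \<omega>\<bar>)"
proof -
  let ?f = "\<lambda>j. \<bar>meas N x s j \<omega> / s i j \<omega>\<bar>"
  have ne: "{..<M} \<noteq> {}" using assms by auto
  have "arg_min_on ?f {..<M} \<in> {..<M}" by (rule arg_min_if_finite[OF _ ne]) simp
  moreover have "?f (arg_min_on ?f {..<M}) \<le> ?f j" if "j < M" for j
    by (rule arg_min_least[OF _ ne]) (use that in auto)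
  ultimately show ?thesis
    unfolding xhat_min_def Let_def by (meson lessThan_iff less_le_trans)
qed

text \<open>Since \<open>x i = 0\<close>, the measurement does not involve \<open>s i j\<close>, so
  the pair of \<open>meas N x s j\<close> and \<open>\<epsilon> * s i j\<close> satisfies
  \<open>prob_abs_less_stable\<close> with \<open>p = \<Theta>\<close> and
  \<open>q = \<epsilon> powr \<alpha>\<close>.\<close>

lemma (in prob_space) prob_abs_ratio_gt:
  fixes s :: "nat \<Rightarrow> nat \<Rightarrow> 'a \<Rightarrow> real"
  assumes indep: "indep_vars (\<lambda>_. borel) (\<lambda>(i, j). s i j) ({..<N} \<times> {..<m})"
    and law: "\<And>i j. i < N \<Longrightarrow> j < m \<Longrightarrow> sas_law \<alpha> (distr M borel (s i j))"
    and "0 < \<alpha>" "0 < \<epsilon>" "i < N" "j < m" "x i = 0"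
    and \<Theta>: "\<Theta> = (\<Sum>k<N. \<bar>x k\<bar> powr \<alpha>)" "0 < \<Theta>" "\<epsilon> powr \<alpha> \<le> \<Theta>"
  shows "prob {\<omega> \<in> space M. \<epsilon> < \<bar>meas N x s j \<omega> / s i j \<omega>\<bar>} \<le> \<Theta> / (\<Theta> + \<epsilon> powr \<alpha>)"
proof -
  have s_meas [measurable]: "s k j \<in> borel_measurable M" if "k < N" for k
    using indep that \<open>j < m\<close> by (auto simp: indep_vars_def)
  have Y [measurable]: "(\<lambda>\<omega>. meas N x s j \<omega>) \<in> borel_measurable M"
    unfolding meas_def by measurable
  have S [measurable]: "(\<lambda>\<omega>. \<epsilon> * s i j \<omega>) \<in> borel_measurable M"
    using s_meas[OF \<open>i < N\<close>] by measurable
  have cf: "expectation (\<lambda>\<omega>. cos (t * meas N x s j \<omega> + u * (\<epsilon> * s i j \<omega>))) =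
      exp (- (\<Theta> * \<bar>t\<bar> powr \<alpha> + \<epsilon> powr \<alpha> * \<bar>u\<bar> powr \<alpha>))" for t u
  proof -
    define z where "z k = t * x k + (if k = i then u * \<epsilon> else 0)" for k
    have "t * meas N x s j \<omega> + u * (\<epsilon> * s i j \<omega>) = (\<Sum>k<N. z k * s k j \<omega>)" for \<omega>
    proof -
      have "(\<Sum>k<N. z k * s k j \<omega>) = (\<Sum>k<N. t * (x k * s k j \<omega>)) + (\<Sum>k<N. if k = i then u * \<epsilon> * s k j \<omega> else 0)"
        unfolding sum.distrib[symmetric] by (intro sum.cong) (auto simp: z_def algebra_simps)
      then show ?thesis
        using \<open>i < N\<close> by (simp add: meas_def sum_distrib_left)
    qed
    \<comment> \<open>Independence is given for the family indexed by pairs, so the sum over column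
      \<open>j\<close> is reindexed by \<open>{..<N} \<times> {j}\<close>.\<close>
    also have "(\<Sum>k<N. z k * s k j \<omega>) = (\<Sum>kj\<in>{..<N} \<times> {j}. z (fst kj) * (case kj of (k, j) \<Rightarrow> s k j) \<omega>)" for \<omega>
      by (subst sum.cartesian_product') simp
    finally have "expectation (\<lambda>\<omega>. cos (t * meas N x s j \<omega> + u * (\<epsilon> * s i j \<omega>))) =
        exp (- (\<Sum>kj\<in>{..<N} \<times> {j}. \<bar>z (fst kj)\<bar> powr \<alpha>))"
      using \<open>j < m\<close> law
      by (simp only:, intro expectation_cos_sum_stable indep_vars_subset[OF indep]) auto
    also have "(\<Sum>kj\<in>{..<N} \<times> {j}. \<bar>z (fst kj)\<bar> powr \<alpha>) = (\<Sum>k<N. \<bar>z k\<bar> powr \<alpha>)"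
      by (subst sum.cartesian_product') simp
    \<comment> \<open>At \<open>k = i\<close> the term with \<open>t\<close> vanishes, so no power
      of a genuine sum occurs.\<close>
    also have "\<dots> = (\<Sum>k<N. \<bar>t\<bar> powr \<alpha> * \<bar>x k\<bar> powr \<alpha> + (if k = i then \<epsilon> powr \<alpha> * \<bar>u\<bar> powr \<alpha> else 0))"
      using \<open>0 < \<epsilon>\<close> \<open>x i = 0\<close>
      by (intro sum.cong) (auto simp: z_def abs_mult powr_mult)
    also have "\<dots> = \<Theta> * \<bar>t\<bar> powr \<alpha> + \<epsilon> powr \<alpha> * \<bar>u\<bar> powr \<alpha>"
      using \<open>i < N\<close> by (simp add: sum.distrib \<Theta> sum_distrib_left mult.commute)
    finally show ?thesis .
  qed
  have "prob {\<omega> \<in> space M. \<epsilon> < \<bar>meas N x s j \<omega> / s i j \<omega>\<bar>} \<le> prob {\<omega> \<in> space M. \<bar>\<epsilon> * s i j \<omega>\<bar> < \<bar>meas N x s j \<omega>\<bar>}"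
  proof (rule finite_measure_mono)
    show "{\<omega> \<in> space M. \<epsilon> < \<bar>meas N x s j \<omega> / s i j \<omega>\<bar>} \<subseteq> {\<omega> \<in> space M. \<bar>\<epsilon> * s i j \<omega>\<bar> < \<bar>meas N x s j \<omega>\<bar>}"
    proof safe
      fix \<omega> assume *: "\<epsilon> < \<bar>meas N x s j \<omega> / s i j \<omega>\<bar>"
      \<comment> \<open>Division by zero yields 0, which does not exceed the positive
        \<open>\<epsilon>\<close>.\<close>
      then have "s i j \<omega> \<noteq> 0" using \<open>0 < \<epsilon>\<close> by auto
      then show "\<bar>\<epsilon> * s i j \<omega>\<bar> < \<bar>meas N x s j \<omega>\<bar>"
        using * \<open>0 < \<epsilon>\<close> by (simp add: abs_mult abs_divide pos_less_divide_eq)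
    qed
  qed measurable
  also have "\<dots> \<le> \<Theta> / (\<Theta> + \<epsilon> powr \<alpha>)"
    using assms by (intro prob_abs_less_stable[OF Y S cf]) auto
  finally show ?thesis .
qed

text \<open>The ratios for different \<open>j\<close> are functions of disjoint columns of the
  independent family, hence independent, and the minimum exceeds \<open>\<epsilon>\<close> exactly
  when all of them do.\<close>

lemma (in prob_space) prob_xhat_min_gt:
  fixes s :: "nat \<Rightarrow> nat \<Rightarrow> 'a \<Rightarrow> real"
  assumes indep: "indep_vars (\<lambda>_. borel) (\<lambda>(i, j). s i j) ({..<N} \<times> {..<m})"
    and "0 < m" "i < N"
    and le: "\<And>j. j < m \<Longrightarrow> prob {\<omega> \<in> space M. \<epsilon> < \<bar>meas N x s j \<omega> / s i j \<omega>\<bar>} \<le> c"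
  shows "{\<omega> \<in> space M. \<epsilon> < \<bar>xhat_min N m x s i \<omega>\<bar>} \<in> events" (is "?A \<in> _")
    and "prob {\<omega> \<in> space M. \<epsilon> < \<bar>xhat_min N m x s i \<omega>\<bar>} \<le> c ^ m"
proof -
  let ?R = "\<lambda>j \<omega>. \<bar>meas N x s j \<omega> / s i j \<omega>\<bar>"
  have "indep_vars (\<lambda>j. PiM ({..<N} \<times> {j}) (\<lambda>_. borel))
      (\<lambda>j \<omega>. restrict (\<lambda>kj. (case kj of (k, j) \<Rightarrow> s k j) \<omega>) ({..<N} \<times> {j})) {..<m}"
    by (rule indep_vars_restrict[OF indep]) (auto simp: disjoint_family_on_def)
  then have "indep_vars (\<lambda>_. borel) (\<lambda>j \<omega>. (\<lambda>f. \<bar>(\<Sum>k<N. x k * f (k, j)) / f (i, j)\<bar>)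
      (restrict (\<lambda>kj. (case kj of (k, j) \<Rightarrow> s k j) \<omega>) ({..<N} \<times> {j}))) {..<m}"
    by (rule indep_vars_compose2[where Y = "\<lambda>j f. \<bar>(\<Sum>k<N. x k * f (k, j)) / f (i, j)\<bar>"])
       (measurable, use \<open>i < N\<close> in auto)
  then have R: "indep_vars (\<lambda>_. borel) ?R {..<m}"
    by (rule indep_vars_cong[THEN iffD1, rotated -1]) (use \<open>i < N\<close> in \<open>auto simp: meas_def fun_eq_iff\<close>)
  then have R_meas: "?R j \<in> borel_measurable M" if "j < m" for j
    using that by (auto simp: indep_vars_def)
  have A: "?A = (\<Inter>j\<in>{..<m}. ?R j -` {\<epsilon><..} \<inter> space M)"
    using \<open>0 < m\<close> by (auto simp: xhat_min_gt_iff)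
  show "?A \<in> events"
    unfolding A using \<open>0 < m\<close> by (intro sets.finite_INT measurable_sets[OF R_meas]) auto
  have "prob ?A = (\<Prod>j\<in>{..<m}. prob (?R j -` {\<epsilon><..} \<inter> space M))"
    unfolding A using \<open>0 < m\<close> by (intro indep_varsD_finite[OF R]) auto
  also have "\<dots> \<le> (\<Prod>j\<in>{..<m}. c)"
  proof (rule prod_mono)
    fix j assume "j \<in> {..<m}"
    moreover have "?R j -` {\<epsilon><..} \<inter> space M = {\<omega> \<in> space M. \<epsilon> < ?R j \<omega>}" by auto
    ultimately show "0 \<le> prob (?R j -` {\<epsilon><..} \<inter> space M) \<and> prob (?R j -` {\<epsilon><..} \<inter> space M) \<le> c"
      using le by simp
  qed
  finally show "prob ?A \<le> c ^ m" by simp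
qed

section \<open>Comparison of the constants and summation over the zero coordinates\<close>

theorem theorem2:
  fixes P :: "'a measure" and s :: "nat \<Rightarrow> nat \<Rightarrow> 'a \<Rightarrow> real"
    and x :: "nat \<Rightarrow> real" and N K M :: nat and \<alpha> \<epsilon> \<delta> :: real
  assumes "prob_space P"
    and "0 < \<alpha>" "\<alpha> < 1"
    and "card {i\<in>{..<N}. x i \<noteq> 0} = K" "0 < K" "K < N"
    and "\<And>i j. i < N \<Longrightarrow> j < M \<Longrightarrow> s i j \<in> borel_measurable P"
    and "prob_space.indep_vars P (\<lambda>_. borel) (\<lambda>(i, j). s i j) ({..<N} \<times> {..<M})"
    and "\<And>i j. i < N \<Longrightarrow> j < M \<Longrightarrow> sas_law \<alpha> (distr P borel (s i j))"
    and "0 < \<epsilon>" "0 < \<delta>"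
    and "\<theta> = (\<Sum>i<N. \<bar>x i\<bar> powr \<alpha>) powr (1 / \<alpha>)"
    and "\<psi> = (\<epsilon> / \<theta>) powr (\<alpha> / (1 - \<alpha>))"
    and "\<psi> \<le> 1 / 3"
    and "real M \<ge> ln ((real N - real K) / \<delta>) / ln (1 + \<psi>)"
  shows "prob_space.expectation P
           (\<lambda>\<omega>. real (card {i\<in>{..<N}. x i = 0 \<and> \<bar>xhat_min N M x s i \<omega>\<bar> > \<epsilon>})) \<le> \<delta>"
proof -
  interpret prob_space P by fact
  define Z where "Z = {i\<in>{..<N}. x i = 0}"
  define \<Theta> where "\<Theta> = (\<Sum>i<N. \<bar>x i\<bar> powr \<alpha>)"
  have fin_Z: "finite Z" and Z_sub: "Z \<subseteq> {..<N}" by (auto simp: Z_def)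
  have "{i\<in>{..<N}. x i \<noteq> 0} = {..<N} - Z" by (auto simp: Z_def)
  then have "K = N - card Z"
    using assms(4) card_Diff_subset[OF fin_Z Z_sub] by simp
  moreover have "card Z \<le> N" using card_mono[OF _ Z_sub] by simp
  ultimately have card_Z: "real (card Z) = real N - real K" by simp
  have "{i\<in>{..<N}. x i \<noteq> 0} \<noteq> {}" using assms(4,5) card_gt_0_iff by metis
  then obtain k where "k < N" "x k \<noteq> 0" by auto
  then have \<Theta>_pos: "0 < \<Theta>"
    unfolding \<Theta>_def by (intro sum_pos2[of _ k]) auto
  have \<theta>: "\<theta> = \<Theta> powr (1 / \<alpha>)" "0 < \<theta>" using assms(12) \<Theta>_pos by (auto simp: \<Theta>_def)
  have \<theta>_powr: "\<theta> powr \<alpha> = \<Theta>" using \<theta> \<Theta>_pos assms(2) by (simp add: powr_powr)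
  have \<psi>_pos: "0 < \<psi>" using \<theta> assms by simp
  have exponent: "0 < \<alpha> / (1 - \<alpha>)" "\<alpha> \<le> \<alpha> / (1 - \<alpha>)"
    using assms(2,3) by (auto simp: field_simps)
  have ratio_le: "\<epsilon> / \<theta> \<le> 1"
  \<comment> \<open>A ratio above 1 would give \<open>\<psi> > 1\<close>, contradicting
    \<open>\<psi> \<le> 1 / 3\<close>.\<close>
  proof (rule ccontr)
    assume "\<not> \<epsilon> / \<theta> \<le> 1"
    then have "1 < \<psi>" unfolding assms(13) using exponent(1) by (intro gr_one_powr) auto
    then show False using assms(14) by simp
  qed
  have \<epsilon>_powr: "\<epsilon> powr \<alpha> = (\<epsilon> / \<theta>) powr \<alpha> * \<Theta>"
    using \<theta> assms \<theta>_powr \<Theta>_pos by (simp add: powr_divide)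
  \<comment> \<open>For a base at most 1, the larger exponent
    \<open>\<alpha> / (1 - \<alpha>)\<close> gives the smaller power.\<close>
  have \<psi>_le: "\<psi> \<le> (\<epsilon> / \<theta>) powr \<alpha>"
    unfolding assms(13) using ratio_le exponent assms \<theta> by (intro powr_mono') auto
  have "(\<epsilon> / \<theta>) powr \<alpha> \<le> 1" using ratio_le assms \<theta> by (intro powr_le1) auto
  then have \<epsilon>_le: "\<epsilon> powr \<alpha> \<le> \<Theta>"
    using \<Theta>_pos by (simp add: \<epsilon>_powr)
  have ratio: "\<Theta> / (\<Theta> + \<epsilon> powr \<alpha>) \<le> 1 / (1 + \<psi>)"
  proof -
    have "\<Theta> * \<psi> \<le> \<epsilon> powr \<alpha>" using mult_right_mono[OF \<psi>_le, of \<Theta>] \<Theta>_pos by (simp add: \<epsilon>_powr mult.commute)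
    then show ?thesis using \<Theta>_pos \<psi>_pos by (simp add: field_simps add_pos_nonneg)
  qed
  have count: "real (card Z) * (1 / (1 + \<psi>)) ^ M \<le> \<delta>"
  proof -
    have pos: "0 < (real N - real K) / \<delta>" using assms by simp
    \<comment> \<open>Exponentiated, the lower bound on \<open>M\<close> says that
      \<open>(1 + \<psi>) ^ M\<close> is at least \<open>(N - K) / \<delta>\<close>.\<close>
    have "ln ((real N - real K) / \<delta>) \<le> real M * ln (1 + \<psi>)"
      using assms(15) \<psi>_pos by (simp add: field_simps)
    also have "\<dots> = ln ((1 + \<psi>) ^ M)" using \<psi>_pos by (simp add: ln_realpow)
    finally have "(real N - real K) / \<delta> \<le> (1 + \<psi>) ^ M" using pos \<psi>_pos by simp
    then show ?thesis using assms(11) \<psi>_pos by (simp add: card_Z field_simps)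
  qed
  define A where "A i = {\<omega> \<in> space P. \<epsilon> < \<bar>xhat_min N M x s i \<omega>\<bar>}" for i
  show ?thesis
  proof (cases "M = 0")
    case True
    \<comment> \<open>here \<open>xhat_min\<close> picks an unspecified index, so the count need not even be measurable\<close>
    have "expectation (\<lambda>\<omega>. real (card {i\<in>{..<N}. x i = 0 \<and> \<bar>xhat_min N M x s i \<omega>\<bar> > \<epsilon>})) \<le> real (card Z)"
      (is "expectation ?f \<le> _")
    \<comment> \<open>The expectation of a nonintegrable function is 0 by convention, so the bound
      holds in that case too.\<close>
    proof (cases "integrable P ?f")
      case True
      have "expectation ?f \<le> expectation (\<lambda>_. real (card Z))"
        using True fin_Z by (intro integral_mono) (auto simp: Z_def intro!: card_mono)
      then show ?thesis by (simp add: prob_space)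
    qed (simp add: not_integrable_integral_eq)
    \<comment> \<open>With \<open>M = 0\<close> the fact \<open>count\<close> reads
      \<open>real (card Z) \<le> \<delta>\<close>.\<close>
    then show ?thesis using count True by simp
  next
    case False
    have A: "A i \<in> events" "prob (A i) \<le> (1 / (1 + \<psi>)) ^ M" if "i \<in> Z" for i
    proof -
      have i: "i < N" "x i = 0" using that by (auto simp: Z_def)
      have "prob {\<omega> \<in> space P. \<epsilon> < \<bar>meas N x s j \<omega> / s i j \<omega>\<bar>} \<le> 1 / (1 + \<psi>)" if "j < M" for j
        using prob_abs_ratio_gt[OF assms(8,9,2,10) i(1) that i(2) \<Theta>_def \<Theta>_pos \<epsilon>_le] ratio by simp
      from prob_xhat_min_gt[OF assms(8) _ i(1) this] False
      show "A i \<in> events" "prob (A i) \<le> (1 / (1 + \<psi>)) ^ M" by (auto simp: A_def)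
    qed
    have "expectation (\<lambda>\<omega>. real (card {i\<in>{..<N}. x i = 0 \<and> \<bar>xhat_min N M x s i \<omega>\<bar> > \<epsilon>}))
        = expectation (\<lambda>\<omega>. \<Sum>i\<in>Z. indicator (A i) \<omega>)"
    proof (rule Bochner_Integration.integral_cong[OF refl])
      fix \<omega> assume "\<omega> \<in> space P"
      then have "{i\<in>{..<N}. x i = 0 \<and> \<bar>xhat_min N M x s i \<omega>\<bar> > \<epsilon>} = {i\<in>Z. \<omega> \<in> A i}"
        by (auto simp: A_def Z_def)
      then show "real (card {i\<in>{..<N}. x i = 0 \<and> \<bar>xhat_min N M x s i \<omega>\<bar> > \<epsilon>}) = (\<Sum>i\<in>Z. indicator (A i) \<omega>)"
        using fin_Z by (simp add: indicator_def sum.If_cases Int_def)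
    qed
    also have "\<dots> = (\<Sum>i\<in>Z. prob (A i))"
      using A by (subst Bochner_Integration.integral_sum) (auto simp: less_top[symmetric])
    also have "\<dots> \<le> real (card Z) * (1 / (1 + \<psi>)) ^ M"
      using A by (intro sum_bounded_above) auto
    finally show ?thesis using count by simp
  qed
qed

end
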